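(* Any game $\Pi$ with size greater than $3$ admits non-isomorphic extensions.
   Context: A tournament on a finite set $J$ is a relation without loops such that for distinct $i,j\in J$ exactly one of $i\to j$, $j\to i$ holds. A game of size $2n-1$ is a tournament on a set of size $2n-1$ in which every vertex has exactly $n-1$ outputs and $n-1$ inputs. Let $\Pi$ be a game on $J$ with $|J|=2n-1$, let $K\subset J$ with $|K|=n$, and let $u,v$ be two additional vertices. The extension of $\Pi$ via $u\to v$ and $K$ is the game $\Gamma$ of size $2n+1$ on $J\cup\{u,v\}$ whose restriction to $J$ is $\Pi$ and with $u\to v$; $i\to u$ and $v\to i$ for all $i\in K$; $u\to j$ and $j\to v$ for all $j\in J\setminus K$. An extension of $\Pi$ is an extension via $u\to v$ and some such $K$. The claim says that there are two extensions of $\Pi$ (for different choices of $K$) which are not isomorphic as tournaments (an isomorphism being a bijection of vertices preserving $\to$ in both directions). *)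

theory Defs
  imports Main
begin

definition tournament :: "'a set \<Rightarrow> 'a rel \<Rightarrow> bool" where
  "tournament J r \<longleftrightarrow>
     finite J \<and> r \<subseteq> J \<times> J \<and> irrefl r \<and>
     (\<forall>i\<in>J. \<forall>j\<in>J. i \<noteq> j \<longrightarrow> ((i, j) \<in> r \<longleftrightarrow> (j, i) \<notin> r))"

text \<open>
  The condition \<open>1 \<le> n\<close> excludes the empty relation, whose size would otherwise be
  \<open>2 * 0 - 1 = 0\<close> by truncated subtraction.
\<close>
definition game :: "nat \<Rightarrow> 'a set \<Rightarrow> 'a rel \<Rightarrow> bool" where
  "game n J r \<longleftrightarrow>
     1 \<le> n \<and> card J = 2 * n - 1 \<and> tournament J r \<and>
     (\<forall>i\<in>J. card {j \<in> J. (i, j) \<in> r} = n - 1 \<and> card {j \<in> J. (j, i) \<in> r} = n - 1)"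

definition extension_via :: "'a set \<Rightarrow> 'a rel \<Rightarrow> 'a \<Rightarrow> 'a \<Rightarrow> 'a set \<Rightarrow> 'a rel" where
  "extension_via J r u v K =
     r \<union> {(u, v)} \<union> K \<times> {u} \<union> {v} \<times> K \<union> {u} \<times> (J - K) \<union> (J - K) \<times> {v}"

text \<open>
  The vertex set of an extension is \<open>J \<union> {u, v}\<close>.
\<close>
definition is_extension ::
    "nat \<Rightarrow> 'a set \<Rightarrow> 'a rel \<Rightarrow> 'a \<Rightarrow> 'a \<Rightarrow> 'a rel \<Rightarrow> bool" where
  "is_extension n J r u v s \<longleftrightarrow>
     (\<exists>K. K \<subseteq> J \<and> card K = n \<and> s = extension_via J r u v K)"

definition tournament_iso :: "'a set \<Rightarrow> 'a rel \<Rightarrow> 'b set \<Rightarrow> 'b rel \<Rightarrow> bool" where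
  "tournament_iso J r J' r' \<longleftrightarrow>
     (\<exists>f. bij_betw f J J' \<and> (\<forall>i\<in>J. \<forall>j\<in>J. (i, j) \<in> r \<longleftrightarrow> (f i, f j) \<in> r'))"

lemma game_extension:
  assumes "game n J r" "u \<noteq> v" "u \<notin> J" "v \<notin> J" "is_extension n J r u v s"
  shows "game (Suc n) (J \<union> {u, v}) s"
proof -
  obtain K where K: "K \<subseteq> J" "card K = n" and s: "s = extension_via J r u v K"
    using assms(5) by (auto simp: is_extension_def)
  have n: "1 \<le> n" and cJ: "card J = 2 * n - 1" and fin: "finite J" and sub: "r \<subseteq> J \<times> J"
    and irr: "irrefl r"
    and tot: "\<And>i j. i \<in> J \<Longrightarrow> j \<in> J \<Longrightarrow> i \<noteq> j \<Longrightarrow> (i, j) \<in> r \<longleftrightarrow> (j, i) \<notin> r"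
    and outs: "\<And>i. i \<in> J \<Longrightarrow> card {j \<in> J. (i, j) \<in> r} = n - 1"
    and ins: "\<And>i. i \<in> J \<Longrightarrow> card {j \<in> J. (j, i) \<in> r} = n - 1"
    using assms(1) unfolding game_def tournament_def by blast+
  let ?J = "J \<union> {u, v}"
  note s' = s[unfolded extension_via_def]
  have finK: "finite K" and cD: "card (J - K) = n - 1"
    using K fin cJ by (auto simp: card_Diff_subset finite_subset)
  have "tournament ?J s"
    unfolding tournament_def
  proof (intro conjI ballI impI)
    show "s \<subseteq> ?J \<times> ?J" using K sub by (auto simp: s')
    show "irrefl s" using irr K assms(2-4) by (auto simp: s' irrefl_def)
    fix i j assume "i \<in> ?J" "j \<in> ?J" "i \<noteq> j"
    then show "(i, j) \<in> s \<longleftrightarrow> (j, i) \<notin> s"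
      using K sub assms(2-4)
      by (cases "i \<in> J"; cases "j \<in> J"; cases "i \<in> K"; cases "j \<in> K") (auto simp: s' tot[of i j])
  qed (use fin in auto)
  moreover have "card {j \<in> ?J. (i, j) \<in> s} = n \<and> card {j \<in> ?J. (j, i) \<in> s} = n"
    if i: "i \<in> ?J" for i
  proof -
    consider "i = u" | "i = v" | "i \<in> J" "i \<in> K" | "i \<in> J" "i \<notin> K" using i by auto
    then show ?thesis
    proof cases
      case 1
      then have "{j \<in> ?J. (i, j) \<in> s} = insert v (J - K)" "{j \<in> ?J. (j, i) \<in> s} = K"
        using K sub assms(2-4) by (auto simp: s')
      then show ?thesis using K cD fin n assms(4) by simp
    next
      case 2
      then have "{j \<in> ?J. (i, j) \<in> s} = K" "{j \<in> ?J. (j, i) \<in> s} = insert u (J - K)"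
        using K sub assms(2-4) by (auto simp: s')
      then show ?thesis using K cD fin n assms(3) by simp
    next
      case 3
      then have "{j \<in> ?J. (i, j) \<in> s} = insert u {j \<in> J. (i, j) \<in> r}"
        "{j \<in> ?J. (j, i) \<in> s} = insert v {j \<in> J. (j, i) \<in> r}"
        using K sub assms(2-4) by (auto simp: s')
      then show ?thesis using outs[OF 3(1)] ins[OF 3(1)] fin n assms(3,4) by simp
    next
      case 4
      then have "{j \<in> ?J. (i, j) \<in> s} = insert v {j \<in> J. (i, j) \<in> r}"
        "{j \<in> ?J. (j, i) \<in> s} = insert u {j \<in> J. (j, i) \<in> r}"
        using K sub assms(2-4) by (auto simp: s')
      then show ?thesis using outs[OF 4(1)] ins[OF 4(1)] fin n assms(3,4) by simp
    qed
  qed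
  moreover have "card ?J = 2 * Suc n - 1" using fin cJ n assms(2-4) by simp
  ultimately show ?thesis by (simp add: game_def)
qed

end

theory Submission
  imports Defs
begin

text \<open>
  Write \<open>c x y\<close> for the number of common outputs of \<open>x\<close> and \<open>y\<close>. For every function \<open>g\<close>, the
  sum of \<open>g (c x y)\<close> over all pairs of vertices is an isomorphism invariant. For \<open>g t = t\<^sup>2\<close>,
  its value on the extension via \<open>K\<close> is a constant plus \<open>8\<close> times the sum of \<open>c\<close> over
  \<open>K \<times> K\<close>. If this does not depend on the \<open>n\<close>-set \<open>K\<close>, then \<open>c\<close> is constant off the
  diagonal, with value \<open>(n - 2) / 2 > 0\<close>. In that doubly regular case, let \<open>g\<close> be the indicator
  of \<open>0\<close>, so that the invariant counts pairs without common output. For a vertex \<open>i\<close> with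
  output set \<open>N\<close>, the extension via \<open>insert i N\<close> has such a pair \<open>(u, i)\<close> besides \<open>(u, v)\<close>,
  while for an input \<open>y\<close> of \<open>i\<close> the extension via \<open>insert y N\<close> has only the pair \<open>(u, v)\<close>.
\<close>

section \<open>Common outputs as an isomorphism invariant\<close>

definition adj :: "'a rel \<Rightarrow> 'a \<Rightarrow> 'a \<Rightarrow> int" where
  "adj r x y = of_bool ((x, y) \<in> r)"

definition codeg :: "'a set \<Rightarrow> 'a rel \<Rightarrow> 'a \<Rightarrow> 'a \<Rightarrow> int" where
  "codeg V r x y = (\<Sum>z\<in>V. adj r x z * adj r y z)"

definition codeg_sum :: "(int \<Rightarrow> int) \<Rightarrow> 'a set \<Rightarrow> 'a rel \<Rightarrow> int" where
  "codeg_sum g V r = (\<Sum>x\<in>V. \<Sum>y\<in>V. g (codeg V r x y))"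

lemma codeg_commute: "codeg V r x y = codeg V r y x"
  by (simp add: codeg_def mult.commute)

lemma codeg_nonneg: "0 \<le> codeg V r x y"
  by (simp add: codeg_def adj_def sum_nonneg)

lemma codeg_sum_iso:
  assumes "tournament_iso V r W s"
  shows "codeg_sum g V r = codeg_sum g W s"
proof -
  obtain f where f: "bij_betw f V W"
    and e: "\<And>i j. i \<in> V \<Longrightarrow> j \<in> V \<Longrightarrow> (i, j) \<in> r \<longleftrightarrow> (f i, f j) \<in> s"
    using assms by (auto simp: tournament_iso_def)
  have c: "codeg W s (f x) (f y) = codeg V r x y" if "x \<in> V" "y \<in> V" for x y
    unfolding codeg_def sum.reindex_bij_betw[OF f, symmetric]
    by (rule sum.cong) (use that in \<open>auto simp: adj_def e\<close>)
  show ?thesis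
    unfolding codeg_sum_def sum.reindex_bij_betw[OF f, symmetric]
    by (intro sum.cong refl) (simp add: c)
qed

lemma sum_indicator_mult:
  fixes f :: "'a \<Rightarrow> int"
  assumes "finite J" "K \<subseteq> J"
  shows "(\<Sum>x\<in>J. of_bool (x \<in> K) * f x) = sum f K"
  using assms by (simp add: Int_absorb1)

lemma sum_indicator:
  assumes "finite J" "K \<subseteq> J"
  shows "(\<Sum>x\<in>J. of_bool (x \<in> K) :: int) = int (card K)"
  using sum_indicator_mult[OF assms, of "\<lambda>_. 1"] by simp

text \<open>Exchanging one element of a \<open>k\<close>-set for another shows that \<open>D\<close>
  is constant on \<open>A\<close>; any single \<open>k\<close>-set then gives
  \<open>k * D a = 0\<close>.\<close>

lemma zero_if_subset_sums_zero:
  fixes D :: "'a \<Rightarrow> int"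
  assumes "finite A" "0 < k" "k < card A"
    and zero: "\<And>L. L \<subseteq> A \<Longrightarrow> card L = k \<Longrightarrow> sum D L = 0"
    and "a \<in> A"
  shows "D a = 0"
proof -
  have eq: "D b = D a" if "b \<in> A" for b
  proof (cases "b = a")
    case False
    \<comment> \<open>The strict bound \<open>k < card A\<close> leaves room for
      \<open>k - 1\<close> elements besides \<open>a\<close> and \<open>b\<close>.\<close>
    have "k - 1 \<le> card (A - {a, b})"
      using assms that False by (simp add: card_Diff_subset)
    then obtain M where M: "M \<subseteq> A - {a, b}" "card M = k - 1" "finite M"
      by (meson obtain_subset_with_card_n)
    have "sum D (insert x M) = 0" if "x \<in> {a, b}" for x
      by (rule zero) (use that M assms \<open>b \<in> A\<close> in \<open>auto simp: card_insert_if\<close>)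
    from this[of a] this[of b] show ?thesis
      using M by (auto simp: sum.insert_if split: if_splits)
  qed simp
  obtain L where L: "L \<subseteq> A" "card L = k"
    by (meson assms(3) less_imp_le obtain_subset_with_card_n)
  have "sum D L = int k * D a"
    using L eq by (simp add: subset_iff)
  then show ?thesis using zero[OF L] assms(2) by simp
qed

section \<open>Counting in a regular tournament\<close>

locale regular_tournament =
  fixes J :: "'a set" and r :: "'a rel" and n :: nat
  assumes game: "game n J r"
begin

abbreviation c :: "'a \<Rightarrow> 'a \<Rightarrow> int" where "c \<equiv> codeg J r"

lemma finite_J: "finite J" and n_pos: "1 \<le> n" and card_J: "card J = 2 * n - 1"
  using game by (auto simp: game_def tournament_def)

lemma int_card_J: "int (card J) = 2 * int n - 1"
  using card_J n_pos by simp

text \<open>The term \<open>of_bool (x = y)\<close> accounts for the absence of loops, which makes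
  reversal a ring identity valid on the diagonal too.\<close>

lemma adj_reverse:
  assumes "x \<in> J" "y \<in> J"
  shows "adj r y x = 1 - of_bool (x = y) - adj r x y"
proof -
  have "x \<noteq> y \<longrightarrow> ((x, y) \<in> r \<longleftrightarrow> (y, x) \<notin> r)" "(x, x) \<notin> r"
    using game assms unfolding game_def tournament_def irrefl_def by blast+
  then show ?thesis by (cases "x = y") (simp_all add: adj_def)
qed

lemma sum_adj_out:
  assumes "x \<in> J"
  shows "(\<Sum>y\<in>J. adj r x y) = int n - 1"
  using game assms n_pos finite_J
  by (simp add: game_def adj_def Int_def)

lemma sum_adj_in:
  assumes "x \<in> J"
  shows "(\<Sum>y\<in>J. adj r y x) = int n - 1"
  using game assms n_pos finite_J
  by (simp add: game_def adj_def Int_def)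

lemma codeg_self:
  assumes "x \<in> J"
  shows "c x x = int n - 1"
  using sum_adj_out[OF assms] by (simp add: codeg_def adj_def flip: of_bool_conj)

text \<open>With adjacency matrix \<open>A\<close>, all-ones matrix \<open>E\<close> and \<open>A\<^sup>T = E - I - A\<close>, both \<open>A A\<^sup>T\<close>
  and \<open>A\<^sup>T A\<close> equal \<open>(n - 1) E - A - A\<^sup>2\<close>.\<close>
lemma codeg_eq_common_in:
  assumes "x \<in> J" "y \<in> J"
  shows "c x y = (\<Sum>z\<in>J. adj r z x * adj r z y)"
proof -
  have "c x y = (\<Sum>z\<in>J. adj r x z * (1 - of_bool (z = y) - adj r z y))"
    unfolding codeg_def by (intro sum.cong refl) (simp add: adj_reverse[of _ y] assms)
  also have "\<dots> = int n - 1 - adj r x y - (\<Sum>z\<in>J. adj r x z * adj r z y)"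
    using assms finite_J
    by (simp add: right_diff_distrib sum_subtractf sum_adj_out
        if_distrib[of "(*) _"] of_bool_def cong: if_cong)
  also have "\<dots> = (\<Sum>z\<in>J. (1 - of_bool (z = x) - adj r x z) * adj r z y)"
    using assms finite_J
    by (simp add: left_diff_distrib sum_subtractf sum_adj_in
        if_distrib[of "\<lambda>t. t * _"] of_bool_def cong: if_cong)
  also have "\<dots> = (\<Sum>z\<in>J. adj r z x * adj r z y)"
    by (intro sum.cong refl) (auto simp: adj_reverse[of x] assms)
  finally show ?thesis .
qed

text \<open>Double counting: each of the \<open>n - 1\<close> outputs of \<open>x\<close> has
  \<open>n - 1\<close> inputs \<open>y\<close>.\<close>

lemma sum_codeg:
  assumes "x \<in> J"
  shows "(\<Sum>y\<in>J. c x y) = (int n - 1)\<^sup>2"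
proof -
  have "(\<Sum>y\<in>J. c x y) = (\<Sum>z\<in>J. adj r x z * (\<Sum>y\<in>J. adj r y z))"
    unfolding codeg_def sum_distrib_left by (rule sum.swap)
  also have "\<dots> = (\<Sum>z\<in>J. adj r x z * (int n - 1))"
    by (intro sum.cong refl) (simp add: sum_adj_in)
  also have "\<dots> = (int n - 1)\<^sup>2"
    using sum_adj_out[OF assms] by (simp add: power2_eq_square flip: sum_distrib_right)
  finally show ?thesis .
qed

text \<open>The sum and its transpose together count each ordered pair of distinct elements of
  \<open>K\<close> exactly once.\<close>

lemma sum_adj_within:
  assumes "K \<subseteq> J" "card K = n"
  shows "2 * (\<Sum>x\<in>K. \<Sum>y\<in>K. adj r x y) = int n * (int n - 1)"
proof -
  have fK: "finite K" using assms finite_J finite_subset by blast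
  have "2 * (\<Sum>x\<in>K. \<Sum>y\<in>K. adj r x y)
      = (\<Sum>x\<in>K. \<Sum>y\<in>K. adj r x y) + (\<Sum>x\<in>K. \<Sum>y\<in>K. adj r y x)"
    by (subst (3) sum.swap) simp
  also have "\<dots> = (\<Sum>x\<in>K. \<Sum>y\<in>K. adj r x y + adj r y x)"
    by (simp add: sum.distrib)
  also have "\<dots> = (\<Sum>x\<in>K. \<Sum>y\<in>K. 1 - of_bool (x = y))"
  proof (intro sum.cong refl)
    fix x y assume "x \<in> K" "y \<in> K"
    then show "adj r x y + adj r y x = 1 - of_bool (x = y)"
      using assms(1) adj_reverse[of x y] by (auto simp: subset_iff)
  qed
  also have "\<dots> = int n * (int n - 1)"
    using fK assms(2) by (simp add: sum_subtractf of_bool_def)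
  finally show ?thesis .
qed

text \<open>Expanding the square counts common inputs of pairs in \<open>K\<close>; regularity,
  through \<open>codeg_eq_common_in\<close>, turns them into common outputs.\<close>

lemma sum_codeg_within:
  assumes "K \<subseteq> J"
  shows "(\<Sum>x\<in>J. (\<Sum>y\<in>K. adj r x y)\<^sup>2) = (\<Sum>x\<in>K. \<Sum>y\<in>K. c x y)"
proof -
  have "(\<Sum>x\<in>J. (\<Sum>y\<in>K. adj r x y)\<^sup>2)
      = (\<Sum>x\<in>J. \<Sum>y\<in>K. \<Sum>z\<in>K. adj r x y * adj r x z)"
    by (simp add: power2_eq_square sum_product)
  also have "\<dots> = (\<Sum>y\<in>K. \<Sum>z\<in>K. \<Sum>x\<in>J. adj r x y * adj r x z)"
    by (subst sum.swap, subst sum.swap) (rule refl)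
  also have "\<dots> = (\<Sum>y\<in>K. \<Sum>z\<in>K. c y z)"
    by (intro sum.cong refl) (use assms codeg_eq_common_in in \<open>auto simp: subset_iff\<close>)
  finally show ?thesis .
qed

section \<open>Codegrees in an extension\<close>

text \<open>A pair within \<open>J\<close> gains exactly one of \<open>u\<close>, \<open>v\<close>
  as common output if \<open>K\<close> does not separate it, and none otherwise. The next two sums
  come from pairing \<open>x\<close> with \<open>v\<close>, whose output set is \<open>K\<close>,
  and with \<open>u\<close>, whose output set is \<open>J - K\<close> together with
  \<open>v\<close>. Since \<open>u\<close> and \<open>v\<close> share no output, they contribute
  \<open>2 * g 0\<close>.\<close>

lemma codeg_sum_extension:
  assumes "K \<subseteq> J" "card K = n" "u \<noteq> v" "u \<notin> J" "v \<notin> J"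
  shows "codeg_sum g (J \<union> {u, v}) (extension_via J r u v K) =
    (\<Sum>x\<in>J. \<Sum>y\<in>J. g (c x y + of_bool (x \<in> K \<longleftrightarrow> y \<in> K)))
    + 2 * (\<Sum>x\<in>J. g (\<Sum>y\<in>K. adj r x y))
    + 2 * (\<Sum>x\<in>J. g (int n - of_bool (x \<in> K) - (\<Sum>y\<in>K. adj r x y)))
    + 2 * g 0 + 2 * g (int n)"
proof -
  define V where "V = J \<union> {u, v}"
  define s where "s = extension_via J r u v K"
  let ?a = "\<lambda>x. \<Sum>y\<in>K. adj r x y"
  let ?b = "\<lambda>x. int n - of_bool (x \<in> K) - ?a x"
  have "r \<subseteq> J \<times> J" using game by (simp add: game_def tournament_def)
  then have notin: "(x, u) \<notin> r" "(u, x) \<notin> r" "(x, v) \<notin> r" "(v, x) \<notin> r" for x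
    using assms(4,5) by auto
  have notin_K: "u \<notin> K" "v \<notin> K" using assms by auto
  have sum_V: "sum f V = sum f J + f u + f v" for f :: "'a \<Rightarrow> int"
  proof -
    have "V = insert u (insert v J)" by (auto simp: V_def)
    then show ?thesis using assms finite_J by simp
  qed
  have "(x, y) \<in> s \<longleftrightarrow> (x, y) \<in> r" if "x \<in> J" "y \<in> J" for x y
    using that assms(4,5) unfolding s_def extension_via_def by blast
  then have A1: "adj s x y = adj r x y" if "x \<in> J" "y \<in> J" for x y
    using that by (simp add: adj_def)
  have "(x, u) \<in> s \<longleftrightarrow> x \<in> K" "(x, v) \<in> s \<longleftrightarrow> x \<notin> K"
    "(u, x) \<in> s \<longleftrightarrow> x \<notin> K" "(v, x) \<in> s \<longleftrightarrow> x \<in> K" if "x \<in> J" for x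
    using that assms(3-5) notin notin_K unfolding s_def extension_via_def by blast+
  then have A2: "adj s x u = of_bool (x \<in> K)" "adj s x v = 1 - of_bool (x \<in> K)"
    "adj s u x = 1 - of_bool (x \<in> K)" "adj s v x = of_bool (x \<in> K)" if "x \<in> J" for x
    using that by (simp_all add: adj_def)
  note A = A1 A2
  have B: "adj s u u = 0" "adj s v v = 0" "adj s u v = 1" "adj s v u = 0"
    using assms(3-5) notin notin_K by (auto simp: s_def adj_def extension_via_def)
  have W: "codeg V s x y = (\<Sum>z\<in>J. adj s x z * adj s y z)
      + adj s x u * adj s y u + adj s x v * adj s y v" for x y
    by (simp add: codeg_def sum_V)
  have k: "(\<Sum>z\<in>J. of_bool (z \<in> K) :: int) = int n"
    using sum_indicator[OF finite_J assms(1)] assms(2) by simp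
  have JJ: "codeg V s x y = c x y + of_bool (x \<in> K \<longleftrightarrow> y \<in> K)" if "x \<in> J" "y \<in> J" for x y
    using that by (auto simp: W A codeg_def[of J r] cong: sum.cong)
  have Jv: "codeg V s x v = ?a x" if "x \<in> J" for x
  proof -
    have "codeg V s x v = (\<Sum>z\<in>J. of_bool (z \<in> K) * adj r x z)"
      using that by (simp add: W A B mult.commute cong: sum.cong)
    then show ?thesis using sum_indicator_mult[OF finite_J assms(1)] by simp
  qed
  have Ju: "codeg V s x u = ?b x" if "x \<in> J" for x
  proof -
    have "codeg V s x u = (\<Sum>z\<in>J. adj r x z - of_bool (z \<in> K) * adj r x z) + 1 - of_bool (x \<in> K)"
      using that by (simp add: W A B algebra_simps cong: sum.cong)
    then show ?thesis using sum_indicator_mult[OF finite_J assms(1)] sum_adj_out[OF that]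
      by (simp add: sum_subtractf)
  qed
  have uJ: "codeg V s u x = codeg V s x u" and vJ: "codeg V s v x = codeg V s x v"
    if "x \<in> J" for x
    by (rule codeg_commute)+
  have "codeg V s u v = 0"
    by (simp add: W A B cong: sum.cong) (auto intro: sum.neutral)
  moreover from this have "codeg V s v u = 0"
    by (subst codeg_commute)
  moreover have "codeg V s v v = int n"
    using k by (simp add: W A B cong: sum.cong flip: of_bool_conj)
  moreover have "codeg V s u u = (\<Sum>z\<in>J. 1 - of_bool (z \<in> K)) + 1"
    by (simp add: W A B cong: sum.cong) (auto intro: sum.cong)
  then have "codeg V s u u = int n"
    using k int_card_J by (simp add: sum_subtractf)
  ultimately show ?thesis
    unfolding codeg_sum_def V_def[symmetric] s_def[symmetric]
    by (simp add: sum_V JJ Ju Jv uJ vJ sum.distrib cong: sum.cong)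
qed

text \<open>The coefficient \<open>8\<close> is \<open>4\<close> from pairs within \<open>J\<close>
  plus \<open>2\<close> each from pairs with \<open>v\<close> and with \<open>u\<close>. All other
  sums involving \<open>K\<close> are fixed by regularity and \<open>card K = n\<close>.\<close>

lemma codeg_sum_square_extension:
  assumes "K \<subseteq> J" "card K = n" "u \<noteq> v" "u \<notin> J" "v \<notin> J"
  shows "codeg_sum power2 (J \<union> {u, v}) (extension_via J r u v K)
    = codeg_sum power2 J r + 8 * (\<Sum>x\<in>K. \<Sum>y\<in>K. c x y) + 2 * (int n)\<^sup>2 + 2 * int n - 1"
proof -
  define m where "m = int n"
  define k :: "'a \<Rightarrow> int" where "k x = of_bool (x \<in> K)" for x
  define a where "a x = (\<Sum>y\<in>K. adj r x y)" for x
  define q where "q = (\<Sum>x\<in>K. \<Sum>y\<in>K. c x y)"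
  define e where "e = (\<Sum>x\<in>J. \<Sum>y\<in>J. c x y)"
  have sk: "sum k J = m"
    using sum_indicator[OF finite_J assms(1)] assms(2) by (simp add: k_def m_def)
  have sJ: "(\<Sum>x\<in>J. 1) = 2 * m - 1" using int_card_J by (simp add: m_def)
  have sks: "(\<Sum>x\<in>J. k x * f x) = sum f K" for f
    using sum_indicator_mult[OF finite_J assms(1)] by (simp add: k_def)
  have sa: "sum a J = m * (m - 1)"
  proof -
    have "sum a J = (\<Sum>y\<in>K. \<Sum>x\<in>J. adj r x y)"
      unfolding a_def by (rule sum.swap)
    also have "\<dots> = (\<Sum>y\<in>K. m - 1)"
      by (intro sum.cong refl) (use assms in \<open>simp add: subset_iff sum_adj_in m_def\<close>)
    finally show ?thesis using assms by (simp add: m_def)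
  qed
  have sa2: "(\<Sum>x\<in>J. (a x)\<^sup>2) = q"
    unfolding a_def q_def by (rule sum_codeg_within[OF assms(1)])
  have saK: "2 * sum a K = m * (m - 1)"
    unfolding a_def m_def by (rule sum_adj_within[OF assms(1,2)])
  have e: "e = (2 * m - 1) * (m - 1)\<^sup>2"
    using int_card_J by (simp add: e_def sum_codeg m_def)
  have q1: "(\<Sum>x\<in>J. \<Sum>y\<in>J. k x * c x y) = m * (m - 1)\<^sup>2"
  proof -
    have "(\<Sum>x\<in>J. \<Sum>y\<in>J. k x * c x y) = (\<Sum>x\<in>J. k x * (m - 1)\<^sup>2)"
      by (simp add: sum_codeg m_def flip: sum_distrib_left)
    then show ?thesis by (simp add: sk flip: sum_distrib_right)
  qed
  have q2: "(\<Sum>x\<in>J. \<Sum>y\<in>J. k y * c x y) = m * (m - 1)\<^sup>2"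
    using q1 by (subst sum.swap) (simp add: codeg_commute)
  have q3: "(\<Sum>x\<in>J. \<Sum>y\<in>J. k x * k y * c x y) = q"
    by (simp add: sks q_def mult.assoc flip: sum_distrib_left)
  have k0: "(\<Sum>x\<in>J. \<Sum>y\<in>J. 1) = (2 * m - 1) * (2 * m - 1)"
    and k1: "(\<Sum>x\<in>J. \<Sum>y\<in>J. k x) = m * (2 * m - 1)"
    and k2: "(\<Sum>x\<in>J. \<Sum>y\<in>J. k y) = m * (2 * m - 1)"
    and k3: "(\<Sum>x\<in>J. \<Sum>y\<in>J. k x * k y) = m\<^sup>2"
    using int_card_J sk
    by (simp_all add: m_def power2_eq_square flip: sum_distrib_left sum_distrib_right)
  have dist: "(\<Sum>x\<in>J. \<Sum>y\<in>J. numeral w * f x y) = numeral w * (\<Sum>x\<in>J. \<Sum>y\<in>J. f x y)"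
    for f :: "'a \<Rightarrow> 'a \<Rightarrow> int" and w
    by (simp add: sum_distrib_left)
  \<comment> \<open>The indicator equals its own square and is the polynomial
    \<open>1 - k x - k y + 2 * (k x * k y)\<close>.\<close>
  have "(\<Sum>x\<in>J. \<Sum>y\<in>J. (c x y + of_bool (x \<in> K \<longleftrightarrow> y \<in> K))\<^sup>2)
    = (\<Sum>x\<in>J. \<Sum>y\<in>J. (c x y)\<^sup>2 + 2 * c x y - 2 * (k x * c x y) - 2 * (k y * c x y)
        + 4 * (k x * k y * c x y) + 1 - k x - k y + 2 * (k x * k y))"
    by (intro sum.cong refl) (simp add: k_def power2_eq_square algebra_simps)
  also have "\<dots> = codeg_sum power2 J r + 2 * e - 2 * (m * (m - 1)\<^sup>2) - 2 * (m * (m - 1)\<^sup>2) + 4 * q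
     + (2 * m - 1) * (2 * m - 1) - m * (2 * m - 1) - m * (2 * m - 1) + 2 * m\<^sup>2"
    unfolding codeg_sum_def e_def
    by (simp only: sum.distrib sum_subtractf dist q1 q2 q3 k0 k1 k2 k3)
  finally have S1: "(\<Sum>x\<in>J. \<Sum>y\<in>J. (c x y + of_bool (x \<in> K \<longleftrightarrow> y \<in> K))\<^sup>2)
    = codeg_sum power2 J r + 2 * e - 2 * (m * (m - 1)\<^sup>2) - 2 * (m * (m - 1)\<^sup>2) + 4 * q
     + (2 * m - 1) * (2 * m - 1) - m * (2 * m - 1) - m * (2 * m - 1) + 2 * m\<^sup>2" .
  \<comment> \<open>Here \<open>k x\<close> is idempotent, and the mixed term
    \<open>k x * a x\<close> sums to the number of arrows inside \<open>K\<close>, known from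
    \<open>saK\<close>.\<close>
  have "(\<Sum>x\<in>J. (int n - of_bool (x \<in> K) - a x)\<^sup>2)
     = (\<Sum>x\<in>J. m\<^sup>2 - 2 * m * a x + (a x)\<^sup>2 + (1 - 2 * m) * k x + 2 * (k x * a x))"
    by (intro sum.cong refl) (simp add: k_def m_def power2_eq_square algebra_simps)
  also have "\<dots> = (2 * m - 1) * m\<^sup>2 - 2 * m * (m * (m - 1)) + q + (1 - 2 * m) * m + m * (m - 1)"
    using sJ saK sk sa sa2 sks[of a]
    by (simp add: sum.distrib sum_subtractf flip: sum_distrib_left sum_distrib_right)
  finally have S2: "(\<Sum>x\<in>J. (int n - of_bool (x \<in> K) - a x)\<^sup>2)
     = (2 * m - 1) * m\<^sup>2 - 2 * m * (m * (m - 1)) + q + (1 - 2 * m) * m + m * (m - 1)" .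
  show ?thesis
    unfolding codeg_sum_extension[OF assms] S1 a_def[symmetric] S2 sa2 q_def[symmetric] e
    unfolding m_def[symmetric]
    by (simp add: power2_eq_square algebra_simps)
qed

section \<open>The doubly regular case\<close>

text \<open>Replacing \<open>a\<close> by \<open>b\<close> in \<open>insert a L\<close> changes the
  double sum by twice a sum over \<open>L\<close>, because all diagonal entries agree. Hence
  \<open>c a z = c b z\<close> by \<open>zero_if_subset_sums_zero\<close>, and the row sum
  \<open>(n - 1)\<^sup>2\<close> determines the common value.\<close>

lemma codeg_const_if_within_const:
  assumes "3 \<le> n"
    and const: "\<And>K L. K \<subseteq> J \<Longrightarrow> L \<subseteq> J \<Longrightarrow> card K = n \<Longrightarrow> card L = n \<Longrightarrow>
      (\<Sum>x\<in>K. \<Sum>y\<in>K. c x y) = (\<Sum>x\<in>L. \<Sum>y\<in>L. c x y)"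
    and "x \<in> J" "y \<in> J" "x \<noteq> y"
  shows "2 * c x y = int n - 2"
proof -
  have swap: "c a z = c b z" if ab: "a \<in> J" "b \<in> J" "z \<in> J" "z \<noteq> a" "z \<noteq> b" "a \<noteq> b" for a b z
  proof -
    have "c a z - c b z = 0"
    proof (rule zero_if_subset_sums_zero[of "J - {a, b}" "n - 1"])
      \<comment> \<open>This reads \<open>n - 1 < 2 * n - 3\<close>, which is exactly
        \<open>3 \<le> n\<close>.\<close>
      show "n - 1 < card (J - {a, b})"
        using assms(1) ab card_J finite_J by (simp add: card_Diff_subset)
      show "(\<Sum>z\<in>L. c a z - c b z) = 0" if L: "L \<subseteq> J - {a, b}" "card L = n - 1" for L
      proof -
        have fL: "finite L" using L finite_J finite_subset by blast
        have exp: "(\<Sum>x\<in>insert d L. \<Sum>y\<in>insert d L. c x y)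
          = int n - 1 + 2 * (\<Sum>z\<in>L. c d z) + (\<Sum>x\<in>L. \<Sum>y\<in>L. c x y)"
          if "d \<in> {a, b}" for d
        proof -
          have d: "d \<notin> L" "d \<in> J" using that L ab by auto
          have "(\<Sum>x\<in>L. c x d) = (\<Sum>x\<in>L. c d x)"
            by (intro sum.cong refl codeg_commute)
          then show ?thesis
            using d fL by (simp add: sum.distrib codeg_self)
        qed
        have "(\<Sum>x\<in>insert a L. \<Sum>y\<in>insert a L. c x y) = (\<Sum>x\<in>insert b L. \<Sum>y\<in>insert b L. c x y)"
          by (rule const) (use L ab fL assms(1) in \<open>auto simp: card_insert_if\<close>)
        then show ?thesis using exp[of a] exp[of b] by (simp add: sum_subtractf)
      qed
    qed (use assms(1) ab finite_J in auto)
    then show ?thesis by simp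
  qed
  have eq: "c x z = c x y" if "z \<in> J - {x}" for z
    using swap[of z y x] that assms(3-) codeg_commute[of J r x z] codeg_commute[of J r x y] by auto
  have "(\<Sum>z\<in>J. c x z) = c x x + (\<Sum>z\<in>J - {x}. c x z)"
    using assms(3) finite_J by (simp add: sum.remove)
  also have "(\<Sum>z\<in>J - {x}. c x z) = (\<Sum>z\<in>J - {x}. c x y)"
    by (rule sum.cong[OF refl eq])
  also have "\<dots> = (2 * int n - 2) * c x y"
    using assms(1,3) card_J finite_J by (simp add: algebra_simps)
  finally have "(int n - 1) * (2 * c x y) = (int n - 1) * (int n - 2)"
    using assms(3) by (simp add: sum_codeg codeg_self power2_eq_square algebra_simps)
  then show ?thesis using assms(1) by simp
qed

end

section \<open>Two choices of \<open>K\<close> told apart\<close>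

theorem proposition11p6:
  fixes J :: "'a set" and r :: "'a rel" and n :: nat and u v :: 'a
  assumes "game n J r" and "card J > 3"
    and "u \<noteq> v" and "u \<notin> J" and "v \<notin> J"
  shows "\<exists>s t. is_extension n J r u v s \<and> is_extension n J r u v t \<and>
           \<not> tournament_iso (J \<union> {u, v}) s (J \<union> {u, v}) t"
proof (rule ccontr)
  interpret regular_tournament J r n using assms(1) by unfold_locales
  let ?F = "\<lambda>g K. codeg_sum g (J \<union> {u, v}) (extension_via J r u v K)"
  assume *: "\<not> ?thesis"
  have F: "?F g K = ?F g L" if "K \<subseteq> J" "L \<subseteq> J" "card K = n" "card L = n" for g K L
    by (rule codeg_sum_iso) (use * that in \<open>auto simp: is_extension_def\<close>)
  have n: "3 \<le> n" using assms(2) card_J by simp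
  have cc: "2 * c x y = int n - 2" if "x \<in> J" "y \<in> J" "x \<noteq> y" for x y
  proof (rule codeg_const_if_within_const[OF n _ that])
    fix K L assume KL: "K \<subseteq> J" "L \<subseteq> J" "card K = n" "card L = n"
    show "(\<Sum>x\<in>K. \<Sum>y\<in>K. c x y) = (\<Sum>x\<in>L. \<Sum>y\<in>L. c x y)"
      using F[OF KL, of power2]
      unfolding codeg_sum_square_extension[OF KL(1,3) assms(3-)]
        codeg_sum_square_extension[OF KL(2,4) assms(3-)] by simp
  qed
  define z :: "int \<Rightarrow> int" where "z t = of_bool (t = 0)" for t
  have z0: "0 \<le> z t" for t by (simp add: z_def)
  \<comment> \<open>Codegrees within \<open>J\<close> are now positive, \<open>n - 1\<close> or
    \<open>(n - 2) / 2\<close>, so pairs within \<open>J\<close> never count.\<close>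
  have zc: "z (c x y + of_bool P) = 0" if "x \<in> J" "y \<in> J" for x y P
    using cc[OF that] codeg_self[of x] that n codeg_nonneg[of J r x y]
    by (cases "x = y") (auto simp: z_def)
  obtain i where i: "i \<in> J" using assms(2) by fastforce
  define N where "N = {j \<in> J. (i, j) \<in> r}"
  have N: "card N = n - 1" "finite N" "i \<notin> N" "N \<subseteq> J"
    using assms(1) i finite_J by (auto simp: N_def game_def tournament_def irrefl_def)
  have "card {j \<in> J. (j, i) \<in> r} = n - 1" using assms(1) i by (simp add: game_def)
  then have "{j \<in> J. (j, i) \<in> r} \<noteq> {}" using n by (intro notI) simp
  then obtain y where y: "y \<in> J" "(y, i) \<in> r" by auto
  have yN: "y \<notin> N" "y \<noteq> i"
    using y adj_reverse[OF i y(1)] adj_reverse[OF i i]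
    by (auto simp: N_def adj_def of_bool_def split: if_splits)
  \<comment> \<open>Outputs of \<open>x\<close> lying in \<open>N\<close> are the common outputs of
    \<open>x\<close> and \<open>i\<close>.\<close>
  have aN: "(\<Sum>w\<in>N. adj r x w) = c x i" for x
    unfolding sum_indicator_mult[OF finite_J N(4), symmetric] codeg_def
    by (intro sum.cong refl) (simp add: N_def adj_def)
  let ?K = "insert i N" and ?L = "insert y N"
  have K: "?K \<subseteq> J" "card ?K = n" and L: "?L \<subseteq> J" "card ?L = n"
    using N i y yN n by auto
  have aK: "(\<Sum>w\<in>?K. adj r i w) = int n - 1"
    using N i aN[of i] codeg_self[OF i] assms(1)
    by (simp add: adj_def game_def tournament_def irrefl_def)
  \<comment> \<open>Since \<open>i\<close> beats all of \<open>N\<close>, it shares no output with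
    \<open>u\<close>. The pairs of \<open>u\<close> with \<open>i\<close> and with \<open>v\<close>,
    each in both orders, give at least \<open>4\<close>.\<close>
  have "?F z ?K \<ge> 2 * (\<Sum>x\<in>J. z (int n - of_bool (x \<in> ?K) - (\<Sum>y\<in>?K. adj r x y))) + 2 * z 0"
    using z0 unfolding codeg_sum_extension[OF K assms(3-)]
    by (simp add: sum_nonneg del: sum.insert)
  moreover have "(\<Sum>x\<in>J. z (int n - of_bool (x \<in> ?K) - (\<Sum>y\<in>?K. adj r x y)))
      \<ge> z (int n - of_bool (i \<in> ?K) - (\<Sum>y\<in>?K. adj r i y))"
    by (rule member_le_sum) (use i finite_J z0 in auto)
  moreover have "z (int n - of_bool (i \<in> ?K) - (\<Sum>y\<in>?K. adj r i y)) = 1"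
    unfolding aK by (simp add: z_def)
  ultimately have FK: "?F z ?K \<ge> 4" by (simp add: z_def)
  have aL: "(\<Sum>w\<in>?L. adj r x w) = c x i + adj r x y" for x
    using N yN aN[of x] by simp
  \<comment> \<open>As \<open>i\<close> does not beat \<open>y\<close> and lies outside
    \<open>?L\<close>, its two values are \<open>n - 1\<close> and \<open>1\<close>. For other
    \<open>x\<close> the first value lies between \<open>(n - 2) / 2\<close> and
    \<open>n / 2\<close>, so the second is at least \<open>(n - 2) / 2\<close>; both are
    positive.\<close>
  have aL0: "z (\<Sum>w\<in>?L. adj r x w) = 0 \<and>
      z (int n - of_bool (x \<in> ?L) - (\<Sum>w\<in>?L. adj r x w)) = 0" if "x \<in> J" for x
  proof (cases "x = i")
    case True
    have "adj r i y = 0" using yN y by (simp add: adj_def N_def)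
    then show ?thesis unfolding aL using True N yN n codeg_self[OF i] by (simp add: z_def)
  next
    case False
    have "0 \<le> adj r x y" "adj r x y \<le> 1" by (auto simp: adj_def)
    then show ?thesis unfolding aL using cc[OF that i False] n by (auto simp: z_def of_bool_def)
  qed
  \<comment> \<open>Only \<open>u\<close> and \<open>v\<close>, in both orders, remain without a
    common output.\<close>
  have "?F z ?L = 2"
    unfolding codeg_sum_extension[OF L assms(3-)] using aL0 zc n
    by (simp add: z_def del: sum.insert)
  then show False using FK F[OF K(1) L(1) K(2) L(2), of z] by simp
qed

end
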